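(* Let $c,\phi\in\mathbb{R}\setminus\{0\}$ and let $K(s)$ be a continuous function on an interval containing $s_0$. There exists a 2-parameter family of helicoidal surfaces of ni-type in $\mathbb{I}^3_{\mathrm{p}}$ with $K$ as the Gaussian curvature (i.e. the Gaussian curvature at the point with parameters $(s,t)$ is $K(s)$) and whose generating curves $\alpha_{k_0,k_1}(s)=(x(s),y(s),0)$, $s$ arc-length parameter, are implicitly given, on intervals around $s_0$ where the expression makes sense, by $$x^2(s)-y^2(s)=k_0+2\int_{s_0}^{s}\left(k_1-\frac{3\varepsilon\phi^2}{c^2}\int_{s_0}^{v}K(w)\,dw\right)^{-\frac13}dv,$$ where $k_0,k_1$ are constants depending on the values of $x,y,x',y'$ at $s=s_0$ and $\varepsilon=x'^2-y'^2=\pm1$ determines the causal character of $\alpha_{k_0,k_1}$.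
   Context: The pseudo-isotropic space $\mathbb{I}^3_{\mathrm{p}}$ is $\mathbb{R}^3$ with the degenerate metric $\langle u,v\rangle_{pz}=u^1v^1-u^2v^2$. For a $C^2$ parameterized surface $\mathbf{x}(u^1,u^2)=(x^1,x^2,x^3)$ write $\mathbf{x}_i=\partial\mathbf{x}/\partial u^i$, $\mathbf{x}_{ij}=\partial^2\mathbf{x}/\partial u^i\partial u^j$, $x^i_k=\partial x^i/\partial u^k$, $X_{ij}=x^i_1x^j_2-x^j_1x^i_2$. The surface is admissible if $X_{12}\neq0$ (equivalently, the induced metric has rank 2). Put $g_{ij}=\langle\mathbf{x}_i,\mathbf{x}_j\rangle_{pz}$, $N_h=\left(\frac{X_{23}}{X_{12}},\frac{X_{13}}{X_{12}},1\right)$, $h_{ij}=\langle N_h,\mathbf{x}_{ij}\rangle_1$, where $\langle u,v\rangle_1=u^1v^1-u^2v^2+u^3v^3$. The Gaussian and mean curvatures are $$K=\frac{h_{11}h_{22}-h_{12}^2}{g_{11}g_{22}-g_{12}^2},\qquad H=\frac12\,\frac{g_{11}h_{22}-2g_{12}h_{12}+g_{22}h_{11}}{g_{11}g_{22}-g_{12}^2};$$ equivalently $K=\det L$, $H=\frac12\mathrm{tr}\,L$ with $L=-D\xi^{\mathrm p}$, $\xi^{\mathrm p}=\left(A,B,\frac12(1-A^2+B^2)\right)$, $A=X_{23}/X_{12}$, $B=X_{13}/X_{12}$. The helicoidal surface of ni-type with generating curve $\alpha(u)=(x(u),y(u),0)$ (a $C^2$ curve) and parameters $c,\phi$ is $$Yh_2(u,t)=(x(u)\cosh(t\phi)+y(u)\sinh(t\phi),\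 x(u)\sinh(t\phi)+y(u)\cosh(t\phi),\ ct),$$ with coordinates $(u^1,u^2)=(u,t)$. Surfaces are assumed admissible, which here means $\phi(xx'-yy')\neq0$. Arc-length parameter means $x'^2-y'^2=\varepsilon\in\{-1,1\}$ ($\varepsilon=1$: spacelike, $\varepsilon=-1$: timelike). For negative numbers, $(\cdot)^{-1/3}$ denotes the real cube root of the reciprocal.
   Formalization: Existence of the curves is stated for k1 ≠ 0 and εk0 < k1^(-2/3), on open intervals around s0 (s0 interior) where ε times the right-hand side F stays below (F'/2)²; no real arc-length curve exists where εF > (F'/2)² (e.g. K=0, ε=1, k1=1, k0=5). *)

theory Defs
  imports "HOL-Analysis.Analysis"
begin

section \<open>Surfaces in the pseudo-isotropic space\<close>

text \<open>A parameterized surface is a function \<open>f\<close> of the two parameters \<open>u\<close> and \<open>v\<close>, the \<open>i\<close>-th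
  coordinate function being \<open>f u v $ i\<close>.\<close>

definition ip_pz :: "real^3 \<Rightarrow> real^3 \<Rightarrow> real" where
  "ip_pz a b = a$1 * b$1 - a$2 * b$2"

definition ip_1 :: "real^3 \<Rightarrow> real^3 \<Rightarrow> real" where
  "ip_1 a b = a$1 * b$1 - a$2 * b$2 + a$3 * b$3"

definition pd1 :: "(real \<Rightarrow> real \<Rightarrow> real^3) \<Rightarrow> real \<Rightarrow> real \<Rightarrow> real^3" where
  "pd1 f u v = vector_derivative (\<lambda>r. f r v) (at u)"

definition pd2 :: "(real \<Rightarrow> real \<Rightarrow> real^3) \<Rightarrow> real \<Rightarrow> real \<Rightarrow> real^3" where
  "pd2 f u v = vector_derivative (\<lambda>r. f u r) (at v)"

definition minorX :: "(real \<Rightarrow> real \<Rightarrow> real^3) \<Rightarrow> 3 \<Rightarrow> 3 \<Rightarrow> real \<Rightarrow> real \<Rightarrow> real" where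
  "minorX f i j u v = pd1 f u v $ i * pd2 f u v $ j - pd1 f u v $ j * pd2 f u v $ i"

definition admissible_at :: "(real \<Rightarrow> real \<Rightarrow> real^3) \<Rightarrow> real \<Rightarrow> real \<Rightarrow> bool" where
  "admissible_at f u v \<longleftrightarrow> minorX f 1 2 u v \<noteq> 0"

definition normal_h :: "(real \<Rightarrow> real \<Rightarrow> real^3) \<Rightarrow> real \<Rightarrow> real \<Rightarrow> real^3" where
  "normal_h f u v =
     vector [minorX f 2 3 u v / minorX f 1 2 u v, minorX f 1 3 u v / minorX f 1 2 u v, 1]"

definition gauss_curvature :: "(real \<Rightarrow> real \<Rightarrow> real^3) \<Rightarrow> real \<Rightarrow> real \<Rightarrow> real" where
  "gauss_curvature f u v =
    (let g11 = ip_pz (pd1 f u v) (pd1 f u v);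
         g12 = ip_pz (pd1 f u v) (pd2 f u v);
         g22 = ip_pz (pd2 f u v) (pd2 f u v);
         h11 = ip_1 (normal_h f u v) (pd1 (pd1 f) u v);
         h12 = ip_1 (normal_h f u v) (pd1 (pd2 f) u v);
         h22 = ip_1 (normal_h f u v) (pd2 (pd2 f) u v)
     in (h11 * h22 - h12\<^sup>2) / (g11 * g22 - g12\<^sup>2))"

section \<open>Helicoidal surfaces of ni-type\<close>

definition helicoidal_ni ::
    "real \<Rightarrow> real \<Rightarrow> (real \<Rightarrow> real) \<Rightarrow> (real \<Rightarrow> real) \<Rightarrow> real \<Rightarrow> real \<Rightarrow> real^3" where
  "helicoidal_ni c \<phi> x y u t =
     vector [x u * cosh (t * \<phi>) + y u * sinh (t * \<phi>),
             x u * sinh (t * \<phi>) + y u * cosh (t * \<phi>),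
             c * t]"

definition has_gauss_curvature ::
    "real \<Rightarrow> real \<Rightarrow> (real \<Rightarrow> real) \<Rightarrow> real set \<Rightarrow> (real \<Rightarrow> real) \<Rightarrow> (real \<Rightarrow> real) \<Rightarrow> bool" where
  "has_gauss_curvature c \<phi> K J x y \<longleftrightarrow>
     (\<forall>s\<in>J. \<forall>t. admissible_at (helicoidal_ni c \<phi> x y) s t \<and>
                gauss_curvature (helicoidal_ni c \<phi> x y) s t = K s)"

text \<open>The domain \<open>J\<close> is meant to be open, so that \<^const>\<open>deriv\<close> is the derivative along \<open>J\<close>.\<close>

definition C2_on :: "real set \<Rightarrow> (real \<Rightarrow> real) \<Rightarrow> bool" where
  "C2_on J f \<longleftrightarrow> f C1_differentiable_on J \<and> deriv f C1_differentiable_on J"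

definition arclength_curve ::
    "real \<Rightarrow> real set \<Rightarrow> (real \<Rightarrow> real) \<Rightarrow> (real \<Rightarrow> real) \<Rightarrow> bool" where
  "arclength_curve \<epsilon> J x y \<longleftrightarrow>
     C2_on J x \<and> C2_on J y \<and> (\<forall>s\<in>J. (deriv x s)\<^sup>2 - (deriv y s)\<^sup>2 = \<epsilon>)"

section \<open>The implicit equation\<close>

text \<open>The interval integral \<open>LBINT v=a..b. f v\<close> is oriented, so \<open>s < s0\<close> is covered; \<^term>\<open>root 3\<close>
  is the real cube root on the whole real line.\<close>

definition radicand ::
    "real \<Rightarrow> real \<Rightarrow> real \<Rightarrow> (real \<Rightarrow> real) \<Rightarrow> real \<Rightarrow> real \<Rightarrow> real \<Rightarrow> real" where
  "radicand \<epsilon> c \<phi> K s0 k1 v = k1 - 3 * \<epsilon> * \<phi>\<^sup>2 / c\<^sup>2 * (LBINT w=s0..v. K w)"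

definition implicit_rhs ::
    "real \<Rightarrow> real \<Rightarrow> real \<Rightarrow> (real \<Rightarrow> real) \<Rightarrow> real \<Rightarrow> real \<Rightarrow> real \<Rightarrow> real \<Rightarrow> real" where
  "implicit_rhs \<epsilon> c \<phi> K s0 k0 k1 s =
     k0 + 2 * (LBINT v=s0..s. root 3 (1 / radicand \<epsilon> c \<phi> K s0 k1 v))"

definition interval_around :: "real \<Rightarrow> real set \<Rightarrow> real set \<Rightarrow> bool" where
  "interval_around s0 I J \<longleftrightarrow> is_interval J \<and> open J \<and> s0 \<in> J \<and> J \<subseteq> I"

definition rhs_defined_on ::
    "real \<Rightarrow> real \<Rightarrow> real \<Rightarrow> (real \<Rightarrow> real) \<Rightarrow> real \<Rightarrow> real \<Rightarrow> real set \<Rightarrow> bool" where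
  "rhs_defined_on \<epsilon> c \<phi> K s0 k1 J \<longleftrightarrow> (\<forall>v\<in>J. radicand \<epsilon> c \<phi> K s0 k1 v \<noteq> 0)"

text \<open>For an arc-length curve one has the identity
  \<open>(x y' - y x')\<^sup>2 = (x x' - y y')\<^sup>2 - \<epsilon> (x\<^sup>2 - y\<^sup>2)\<close>.  A curve with \<open>x\<^sup>2 - y\<^sup>2\<close> equal to the
  right-hand side \<open>F\<close> has \<open>x x' - y y' = F' / 2\<close>, the cube root below, so it can exist only where
  \<open>\<epsilon> F \<le> (F' / 2)\<^sup>2\<close>.  The boundary case is excluded: for \<open>K = 0\<close> and equality at \<open>s0\<close>, the
  inequality fails on one side of \<open>s0\<close>.\<close>

definition curve_solvable_on ::
    "real \<Rightarrow> real \<Rightarrow> real \<Rightarrow> (real \<Rightarrow> real) \<Rightarrow> real \<Rightarrow> real \<Rightarrow> real \<Rightarrow> real set \<Rightarrow> bool" where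
  "curve_solvable_on \<epsilon> c \<phi> K s0 k0 k1 J \<longleftrightarrow>
     (\<forall>s\<in>J. \<epsilon> * implicit_rhs \<epsilon> c \<phi> K s0 k0 k1 s < (root 3 (1 / radicand \<epsilon> c \<phi> K s0 k1 s))\<^sup>2)"

definition implicit_equation ::
    "real \<Rightarrow> real \<Rightarrow> real \<Rightarrow> (real \<Rightarrow> real) \<Rightarrow> real \<Rightarrow> real \<Rightarrow> real \<Rightarrow> real set \<Rightarrow>
     (real \<Rightarrow> real) \<Rightarrow> (real \<Rightarrow> real) \<Rightarrow> bool" where
  "implicit_equation \<epsilon> c \<phi> K s0 k0 k1 J x y \<longleftrightarrow>
     (\<forall>s\<in>J. (x s)\<^sup>2 - (y s)\<^sup>2 = implicit_rhs \<epsilon> c \<phi> K s0 k0 k1 s)"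

end

theory Submission
  imports Defs
begin

text \<open>
  Along an arc-length curve put \<open>g = x x' - y y'\<close>, half the derivative of \<open>x\<^sup>2 - y\<^sup>2\<close>.  The
  helicoidal motion acts on the first two coordinates by hyperbolic rotations, which preserve the
  Lorentz form, so the curvature of the surface does not depend on \<open>t\<close>.  Differentiating the
  arc-length condition eliminates the second derivatives of the curve, and what remains is
  \<open>K = \<epsilon> c\<^sup>2 / \<phi>\<^sup>2 * g' / g ^ 4\<close> (\<open>helicoidal_ni_curvature_arclength\<close>).  This is the separable
  equation \<open>(1 / g ^ 3)' = - 3 \<epsilon> \<phi>\<^sup>2 / c\<^sup>2 * K\<close>, solved by \<open>g = root 3 (1 / R)\<close> with \<open>R\<close> the
  radicand of the implicit equation.  Hence any arc-length curve satisfying the implicit equation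
  has the required curvature, and evaluation at \<open>s0\<close> gives the two constants.

  For existence a curve must be recovered from \<open>F = x\<^sup>2 - y\<^sup>2\<close> and its arc-length condition.  In
  the Lorentz frame formed by the unit tangent \<open>T\<close> and its reflection \<open>N\<close> in the diagonal, the
  position vector is \<open>\<epsilon> g T + \<mu> N\<close>, and its square is \<open>F\<close> exactly if \<open>\<mu>\<^sup>2 = g\<^sup>2 - \<epsilon> F\<close>;
  solvability says that the right-hand side is positive.  The frame is turned by a hyperbolic
  angle \<open>\<theta>\<close>, and the position has derivative \<open>T\<close> exactly if \<open>\<epsilon> g' + \<mu> \<theta>' = 1\<close> and
  \<open>\<mu>' = - \<epsilon> g \<theta>'\<close>.  The first condition gives \<open>\<theta>\<close> by one integration, and the second then
  follows from \<open>F' = 2 g\<close> (\<open>moving_frame_curve\<close>, \<open>curve_solves_implicit_equation\<close>).  All these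
  functions are given by formulas that do not mention the interval, so a single curve serves for
  all intervals around \<open>s0\<close> on which the equation is solvable.
\<close>

section \<open>Curvature of helicoidal surfaces\<close>

lemma has_vector_derivative_vector_3:
  fixes f g h :: "real \<Rightarrow> real"
  assumes "(f has_real_derivative a) F" "(g has_real_derivative b) F" "(h has_real_derivative c) F"
  shows "((\<lambda>r. vector [f r, g r, h r] :: real^3) has_vector_derivative vector [a, b, c]) F"
proof -
  have eq: "(vector [p, q, r] :: real^3) =
      p *\<^sub>R axis 1 1 + q *\<^sub>R axis 2 1 + r *\<^sub>R axis 3 1" for p q r :: real
    by (simp add: vec_eq_iff forall_3 axis_def)
  show ?thesis
    unfolding eq
    by (intro has_vector_derivative_add
        bounded_linear.has_vector_derivative[OF bounded_linear_scaleR_left]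
        assms[unfolded has_real_derivative_iff_has_vector_derivative])
qed

lemma pd1_helicoidal_ni:
  assumes "(x has_real_derivative x') (at u)" "(y has_real_derivative y') (at u)"
  shows "pd1 (helicoidal_ni c \<phi> x y) u t =
     vector [x' * cosh (t * \<phi>) + y' * sinh (t * \<phi>), x' * sinh (t * \<phi>) + y' * cosh (t * \<phi>), 0]"
  unfolding pd1_def helicoidal_ni_def
  by (rule vector_derivative_at, rule has_vector_derivative_vector_3)
     (auto intro!: derivative_eq_intros assms)

lemma pd2_helicoidal_ni:
  "pd2 (helicoidal_ni c \<phi> x y) u t =
     vector [\<phi> * (x u * sinh (t * \<phi>) + y u * cosh (t * \<phi>)),
             \<phi> * (x u * cosh (t * \<phi>) + y u * sinh (t * \<phi>)), c]"
  unfolding pd2_def helicoidal_ni_def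
  by (rule vector_derivative_at, rule has_vector_derivative_vector_3)
     (auto intro!: derivative_eq_intros simp: algebra_simps)

lemma pd1_pd2_helicoidal_ni:
  assumes "(x has_real_derivative x') (at u)" "(y has_real_derivative y') (at u)"
  shows "pd1 (pd2 (helicoidal_ni c \<phi> x y)) u t =
     vector [\<phi> * (x' * sinh (t * \<phi>) + y' * cosh (t * \<phi>)),
             \<phi> * (x' * cosh (t * \<phi>) + y' * sinh (t * \<phi>)), 0]"
  unfolding pd1_def pd2_helicoidal_ni
  by (rule vector_derivative_at, rule has_vector_derivative_vector_3)
     (auto intro!: derivative_eq_intros assms)

lemma pd2_pd2_helicoidal_ni:
  "pd2 (pd2 (helicoidal_ni c \<phi> x y)) u t =
     vector [\<phi>\<^sup>2 * (x u * cosh (t * \<phi>) + y u * sinh (t * \<phi>)),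
             \<phi>\<^sup>2 * (x u * sinh (t * \<phi>) + y u * cosh (t * \<phi>)), 0]"
  unfolding pd2_def[of "pd2 _"] pd2_helicoidal_ni
  by (rule vector_derivative_at, rule has_vector_derivative_vector_3)
     (auto intro!: derivative_eq_intros simp: algebra_simps power2_eq_square)

lemma pd1_pd1_helicoidal_ni:
  assumes "open J" "u \<in> J"
    and "\<And>s. s \<in> J \<Longrightarrow> (x has_real_derivative x1 s) (at s)"
    and "\<And>s. s \<in> J \<Longrightarrow> (y has_real_derivative y1 s) (at s)"
    and x2: "(x1 has_real_derivative x2) (at u)" and y2: "(y1 has_real_derivative y2) (at u)"
  shows "pd1 (pd1 (helicoidal_ni c \<phi> x y)) u t =
     vector [x2 * cosh (t * \<phi>) + y2 * sinh (t * \<phi>), x2 * sinh (t * \<phi>) + y2 * cosh (t * \<phi>), 0]"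
proof -
  have "((\<lambda>r. vector [x1 r * cosh (t * \<phi>) + y1 r * sinh (t * \<phi>),
                      x1 r * sinh (t * \<phi>) + y1 r * cosh (t * \<phi>), 0] :: real^3)
      has_vector_derivative
      vector [x2 * cosh (t * \<phi>) + y2 * sinh (t * \<phi>), x2 * sinh (t * \<phi>) + y2 * cosh (t * \<phi>), 0])
      (at u)"
    by (rule has_vector_derivative_vector_3) (auto intro!: derivative_eq_intros x2 y2)
  then have "((\<lambda>r. pd1 (helicoidal_ni c \<phi> x y) r t) has_vector_derivative
      vector [x2 * cosh (t * \<phi>) + y2 * sinh (t * \<phi>), x2 * sinh (t * \<phi>) + y2 * cosh (t * \<phi>), 0])
      (at u)"
    by (rule has_vector_derivative_transform_within_open[OF _ assms(1,2)])
       (simp add: pd1_helicoidal_ni[OF assms(3,4)])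
  then show ?thesis
    unfolding pd1_def[of "pd1 _"] by (rule vector_derivative_at)
qed

text \<open>The curve is allowed any parameter here.  The dependence on \<open>t\<close> cancels in every coefficient
  of the two fundamental forms by \<open>cosh\<^sup>2 - sinh\<^sup>2 = 1\<close>, and the first fundamental form has
  determinant \<open>- (\<phi> g)\<^sup>2\<close>.\<close>
lemma helicoidal_ni_curvature:
  fixes x y x1 y1 :: "real \<Rightarrow> real"
  assumes J: "open J" "u \<in> J"
    and x1: "\<And>s. s \<in> J \<Longrightarrow> (x has_real_derivative x1 s) (at s)"
    and y1: "\<And>s. s \<in> J \<Longrightarrow> (y has_real_derivative y1 s) (at s)"
    and x2: "(x1 has_real_derivative x2) (at u)" and y2: "(y1 has_real_derivative y2) (at u)"
    and "\<phi> \<noteq> 0" and g: "g = x u * x1 u - y u * y1 u" "g \<noteq> 0"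
  shows "admissible_at (helicoidal_ni c \<phi> x y) u t"
    and "gauss_curvature (helicoidal_ni c \<phi> x y) u t =
      c\<^sup>2 / (\<phi>\<^sup>2 * g ^ 4) *
        (((x1 u)\<^sup>2 - (y1 u)\<^sup>2)\<^sup>2 - (y1 u * x2 - x1 u * y2) * (x u * y1 u - y u * x1 u))"
proof -
  let ?f = "helicoidal_ni c \<phi> x y"
  define C where "C = cosh (t * \<phi>)"
  define S where "S = sinh (t * \<phi>)"
  have CS: "C\<^sup>2 - S\<^sup>2 = 1"
    unfolding C_def S_def by (rule hyperbolic_pythagoras)
  note pd = pd1_helicoidal_ni[OF x1 y1, OF J(2) J(2)] pd2_helicoidal_ni
    pd1_pd2_helicoidal_ni[OF x1 y1, OF J(2) J(2)]
    pd2_pd2_helicoidal_ni C_def[symmetric] S_def[symmetric]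
  have X12: "minorX ?f 1 2 u t = \<phi> * g"
    unfolding minorX_def pd g(1) using CS by (simp, algebra)
  show "admissible_at ?f u t"
    unfolding admissible_at_def X12 using g(2) \<open>\<phi> \<noteq> 0\<close> by simp
  have X23: "minorX ?f 2 3 u t = c * (x1 u * S + y1 u * C)"
    unfolding minorX_def pd by simp
  have X13: "minorX ?f 1 3 u t = c * (x1 u * C + y1 u * S)"
    unfolding minorX_def pd by simp
  have g11: "ip_pz (pd1 ?f u t) (pd1 ?f u t) = (x1 u)\<^sup>2 - (y1 u)\<^sup>2"
    unfolding ip_pz_def pd using CS by (simp, algebra)
  have g12: "ip_pz (pd1 ?f u t) (pd2 ?f u t) = \<phi> * (x1 u * y u - y1 u * x u)"
    unfolding ip_pz_def pd using CS by (simp, algebra)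
  have g22: "ip_pz (pd2 ?f u t) (pd2 ?f u t) = \<phi>\<^sup>2 * ((y u)\<^sup>2 - (x u)\<^sup>2)"
    unfolding ip_pz_def pd using CS by (simp, algebra)
  have ip_h: "ip_1 (normal_h ?f u t) (vector [p, q, 0]) =
      c / (\<phi> * g) * ((x1 u * S + y1 u * C) * p - (x1 u * C + y1 u * S) * q)" for p q
    unfolding ip_1_def normal_h_def X12 X13 X23 by (simp add: diff_divide_distrib right_diff_distrib)
  have pd11: "pd1 (pd1 ?f) u t = vector [x2 * C + y2 * S, x2 * S + y2 * C, 0]"
    unfolding C_def S_def by (rule pd1_pd1_helicoidal_ni[OF J x1 y1 x2 y2])
  have h11: "ip_1 (normal_h ?f u t) (pd1 (pd1 ?f) u t) =
      c / (\<phi> * g) * (y1 u * x2 - x1 u * y2)"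
    unfolding pd11 ip_h by (rule arg_cong[where f = "(*) _"]) (use CS in algebra)
  have h12: "ip_1 (normal_h ?f u t) (pd1 (pd2 ?f) u t) =
      c / (\<phi> * g) * (- \<phi> * ((x1 u)\<^sup>2 - (y1 u)\<^sup>2))"
    unfolding pd ip_h by (rule arg_cong[where f = "(*) _"]) (use CS in algebra)
  have h22: "ip_1 (normal_h ?f u t) (pd2 (pd2 ?f) u t) =
      c / (\<phi> * g) * (\<phi>\<^sup>2 * (x u * y1 u - y u * x1 u))"
    unfolding pd ip_h by (rule arg_cong[where f = "(*) _"]) (use CS in algebra)
  have det: "((x1 u)\<^sup>2 - (y1 u)\<^sup>2) * (\<phi>\<^sup>2 * ((y u)\<^sup>2 - (x u)\<^sup>2)) - (\<phi> * (x1 u * y u - y1 u * x u))\<^sup>2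
      = - (\<phi>\<^sup>2 * g\<^sup>2)"
    unfolding g(1) by algebra
  have quotient: "(k * P * (k * (\<phi>\<^sup>2 * Q)) - (k * (- \<phi> * E))\<^sup>2) / - (\<phi>\<^sup>2 * g\<^sup>2) =
      k\<^sup>2 / g\<^sup>2 * (E\<^sup>2 - P * Q)" for k P Q E :: real
  proof -
    have "k * P * (k * (\<phi>\<^sup>2 * Q)) - (k * (- \<phi> * E))\<^sup>2 = - (\<phi>\<^sup>2 * (k\<^sup>2 * (E\<^sup>2 - P * Q)))"
      by algebra
    then show ?thesis
      using \<open>\<phi> \<noteq> 0\<close> by simp
  qed
  have "(c / (\<phi> * g))\<^sup>2 / g\<^sup>2 = c\<^sup>2 / (\<phi>\<^sup>2 * g ^ 4)"
    by (simp add: power_divide power_mult_distrib flip: power_add)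
  then show "gauss_curvature ?f u t = c\<^sup>2 / (\<phi>\<^sup>2 * g ^ 4) *
        (((x1 u)\<^sup>2 - (y1 u)\<^sup>2)\<^sup>2 - (y1 u * x2 - x1 u * y2) * (x u * y1 u - y u * x1 u))"
    unfolding gauss_curvature_def Let_def g11 g12 g22 h11 h12 h22 det quotient by simp
qed

text \<open>Arc length gives \<open>x' x'' = y' y''\<close>.  With this relation the product of the two minors in the
  general formula collapses to \<open>\<epsilon> (y y'' - x x'')\<close>, and the whole bracket to
  \<open>\<epsilon> (\<epsilon> + x x'' - y y'') = \<epsilon> g'\<close>.\<close>
lemma helicoidal_ni_curvature_arclength:
  fixes x y x1 y1 :: "real \<Rightarrow> real"
  assumes J: "open J" "u \<in> J"
    and x1: "\<And>s. s \<in> J \<Longrightarrow> (x has_real_derivative x1 s) (at s)"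
    and y1: "\<And>s. s \<in> J \<Longrightarrow> (y has_real_derivative y1 s) (at s)"
    and x2: "(x1 has_real_derivative x2) (at u)" and y2: "(y1 has_real_derivative y2) (at u)"
    and arc: "\<And>s. s \<in> J \<Longrightarrow> (x1 s)\<^sup>2 - (y1 s)\<^sup>2 = \<epsilon>"
    and "\<phi> \<noteq> 0" and g: "\<And>s. s \<in> J \<Longrightarrow> x s * x1 s - y s * y1 s = g s"
    and g': "(g has_real_derivative g') (at u)" "g u \<noteq> 0"
  shows "admissible_at (helicoidal_ni c \<phi> x y) u t"
    and "gauss_curvature (helicoidal_ni c \<phi> x y) u t = \<epsilon> * c\<^sup>2 / \<phi>\<^sup>2 * (g' / g u ^ 4)"
proof -
  note * = helicoidal_ni_curvature[OF J x1 y1 x2 y2 \<open>\<phi> \<noteq> 0\<close> g[OF J(2), symmetric] g'(2), of c t]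
  show "admissible_at (helicoidal_ni c \<phi> x y) u t"
    by (rule *(1))
  \<comment> \<open>\<open>x1\<close> and \<open>y1\<close> satisfy the arc-length condition on a neighbourhood, so it may be
    differentiated at \<open>u\<close>.\<close>
  have "((\<lambda>s. (x1 s)\<^sup>2 - (y1 s)\<^sup>2) has_real_derivative 2 * (x1 u * x2 - y1 u * y2)) (at u)"
    by (auto intro!: derivative_eq_intros x2 y2 simp: algebra_simps)
  moreover have "((\<lambda>s. (x1 s)\<^sup>2 - (y1 s)\<^sup>2) has_real_derivative 0) (at u)"
    by (rule has_field_derivative_transform_within_open[OF DERIV_const J]) (simp add: arc)
  ultimately have orth: "x1 u * x2 - y1 u * y2 = 0"
    using DERIV_unique by fastforce
  have "((\<lambda>s. x s * x1 s - y s * y1 s) has_real_derivative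
      (x1 u)\<^sup>2 + x u * x2 - ((y1 u)\<^sup>2 + y u * y2)) (at u)"
    by (auto intro!: derivative_eq_intros x1 y1 x2 y2 J(2) simp: power2_eq_square)
  moreover have "((\<lambda>s. x s * x1 s - y s * y1 s) has_real_derivative g') (at u)"
    by (rule has_field_derivative_transform_within_open[OF g'(1) J]) (simp add: g)
  ultimately have g'_eq: "g' = \<epsilon> + x u * x2 - y u * y2"
    using DERIV_unique arc[OF J(2)] by fastforce
  have "(y1 u * x2 - x1 u * y2) * (x u * y1 u - y u * x1 u) =
      (x u * x1 u - y u * y1 u) * (x1 u * x2 - y1 u * y2)
      - ((x1 u)\<^sup>2 - (y1 u)\<^sup>2) * (x u * x2 - y u * y2)"
    by algebra
  then have "\<epsilon>\<^sup>2 - (y1 u * x2 - x1 u * y2) * (x u * y1 u - y u * x1 u) = \<epsilon> * g'"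
    unfolding orth arc[OF J(2)] g'_eq by (simp add: algebra_simps power2_eq_square)
  then show "gauss_curvature (helicoidal_ni c \<phi> x y) u t = \<epsilon> * c\<^sup>2 / \<phi>\<^sup>2 * (g' / g u ^ 4)"
    using *(2) arc[OF J(2)] by simp
qed

section \<open>The implicit equation\<close>

lemma interval_integral_has_real_derivative:
  fixes f :: "real \<Rightarrow> real"
  assumes "is_interval J" "open J" "a \<in> J" "s \<in> J" "continuous_on J f"
  shows "((\<lambda>u. LBINT v=a..u. f v) has_real_derivative f s) (at s)"
proof -
  obtain e where e: "e > 0" "cball s e \<subseteq> J"
    using assms(2,4) open_contains_cball by blast
  \<comment> \<open>A compact interval in \<open>J\<close> that contains the base point and has \<open>s\<close> in its interior,
    so that a derivative within it is a derivative at \<open>s\<close>.\<close>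
  define l where "l = min a (s - e)"
  define r where "r = max a (s + e)"
  have "s - e \<in> J" "s + e \<in> J"
    using e by (auto simp: dist_real_def intro!: subsetD[OF e(2)])
  then have "l \<in> J" "r \<in> J"
    using assms(3) by (simp_all add: l_def r_def min_def max_def)
  then have sub: "{l..r} \<subseteq> J"
    by (meson mem_is_interval_1_I[OF assms(1)] atLeastAtMost_iff subsetI)
  have "((\<lambda>u. LBINT v=a..u. f v) has_vector_derivative f s) (at s within {l..r})"
    using e(1) by (intro interval_integral_FTC2 continuous_on_subset[OF assms(5) sub])
      (simp_all add: l_def r_def min_def max_def)
  moreover have "at s within {l..r} = at s"
    using e(1) by (intro at_within_interior) (simp add: l_def r_def min_def max_def)
  ultimately show ?thesis
    by (simp add: has_real_derivative_iff_has_vector_derivative)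
qed

text \<open>Half the derivative of the right-hand side of the implicit equation, hence the value of
  \<open>x x' - y y'\<close> for a curve satisfying it.\<close>
definition implicit_slope ::
    "real \<Rightarrow> real \<Rightarrow> real \<Rightarrow> (real \<Rightarrow> real) \<Rightarrow> real \<Rightarrow> real \<Rightarrow> real \<Rightarrow> real" where
  "implicit_slope \<epsilon> c \<phi> K s0 k1 s = root 3 (1 / radicand \<epsilon> c \<phi> K s0 k1 s)"

lemma implicit_slope_power3: "implicit_slope \<epsilon> c \<phi> K s0 k1 s ^ 3 = 1 / radicand \<epsilon> c \<phi> K s0 k1 s"
  unfolding implicit_slope_def by (simp add: odd_real_root_pow)

lemma radicand_start: "radicand \<epsilon> c \<phi> K s0 k1 s0 = k1"
  by (simp add: radicand_def)

lemma implicit_rhs_start: "implicit_rhs \<epsilon> c \<phi> K s0 k0 k1 s0 = k0"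
  by (simp add: implicit_rhs_def)

lemma radicand_has_real_derivative:
  assumes "is_interval J" "open J" "s0 \<in> J" "s \<in> J" "continuous_on J K"
  shows "(radicand \<epsilon> c \<phi> K s0 k1 has_real_derivative - (3 * \<epsilon> * \<phi>\<^sup>2 / c\<^sup>2 * K s)) (at s)"
  unfolding radicand_def
  by (rule derivative_eq_intros interval_integral_has_real_derivative[OF assms] refl)+ simp

text \<open>This differential equation says that the curvature formula for arc-length curves returns
  \<open>K\<close>.  The real cube root is differentiable away from zero, also at negative arguments.\<close>
lemma implicit_slope_has_real_derivative:
  assumes "is_interval J" "open J" "s0 \<in> J" "s \<in> J" "continuous_on J K"
    and R: "radicand \<epsilon> c \<phi> K s0 k1 s \<noteq> 0"
  shows "(implicit_slope \<epsilon> c \<phi> K s0 k1 has_real_derivative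
     \<epsilon> * \<phi>\<^sup>2 / c\<^sup>2 * K s * implicit_slope \<epsilon> c \<phi> K s0 k1 s ^ 4) (at s)"
proof -
  define R where "R = radicand \<epsilon> c \<phi> K s0 k1"
  define g where "g = implicit_slope \<epsilon> c \<phi> K s0 k1"
  have gR: "g s ^ 3 = 1 / R s"
    unfolding g_def R_def by (rule implicit_slope_power3)
  have "R s \<noteq> 0"
    using R unfolding R_def .
  with gR have "g s \<noteq> 0" by auto
  have "((\<lambda>u. root 3 (1 / R u)) has_real_derivative
      inverse (real 3 * root 3 (1 / R s) ^ (3 - Suc 0)) *
        (3 * \<epsilon> * \<phi>\<^sup>2 / c\<^sup>2 * K s / (R s)\<^sup>2)) (at s)"
  proof (rule DERIV_chain2[where f = "root 3" and g = "\<lambda>u. 1 / R u"])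
    show "((\<lambda>u. 1 / R u) has_real_derivative 3 * \<epsilon> * \<phi>\<^sup>2 / c\<^sup>2 * K s / (R s)\<^sup>2) (at s)"
      unfolding R_def
      by (rule derivative_eq_intros radicand_has_real_derivative[OF assms(1-5)] refl R)+
         (simp add: power2_eq_square)
  qed (use \<open>R s \<noteq> 0\<close> in \<open>intro DERIV_odd_real_root; simp\<close>)
  moreover have "root 3 (1 / R u) = g u" for u
    by (simp add: g_def R_def implicit_slope_def)
  ultimately have "(g has_real_derivative
      inverse (3 * (g s)\<^sup>2) * (3 * \<epsilon> * \<phi>\<^sup>2 / c\<^sup>2 * K s * (1 / R s)\<^sup>2)) (at s)"
    by (simp add: power_divide)
  also have "inverse (3 * (g s)\<^sup>2) * (3 * \<epsilon> * \<phi>\<^sup>2 / c\<^sup>2 * K s * (1 / R s)\<^sup>2) =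
      \<epsilon> * \<phi>\<^sup>2 / c\<^sup>2 * K s * ((g s ^ 3)\<^sup>2 / (g s)\<^sup>2)"
    unfolding gR by (simp add: field_simps)
  also have "(g s ^ 3)\<^sup>2 / (g s)\<^sup>2 = g s ^ 4"
    using \<open>g s \<noteq> 0\<close> by (simp add: field_simps flip: power_mult power_add)
  finally show ?thesis
    unfolding g_def .
qed

lemma continuous_on_implicit_slope:
  assumes "is_interval J" "open J" "s0 \<in> J" "continuous_on J K"
    and "rhs_defined_on \<epsilon> c \<phi> K s0 k1 J"
  shows "continuous_on J (implicit_slope \<epsilon> c \<phi> K s0 k1)"
proof (rule DERIV_continuous_on)
  fix s assume "s \<in> J"
  then show "(implicit_slope \<epsilon> c \<phi> K s0 k1 has_real_derivative
     \<epsilon> * \<phi>\<^sup>2 / c\<^sup>2 * K s * implicit_slope \<epsilon> c \<phi> K s0 k1 s ^ 4) (at s within J)"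
    using assms
    by (intro has_field_derivative_at_within[OF implicit_slope_has_real_derivative])
       (simp_all add: rhs_defined_on_def)
qed

lemma implicit_rhs_has_real_derivative:
  assumes "is_interval J" "open J" "s0 \<in> J" "s \<in> J" "continuous_on J K"
    and "rhs_defined_on \<epsilon> c \<phi> K s0 k1 J"
  shows "(implicit_rhs \<epsilon> c \<phi> K s0 k0 k1 has_real_derivative
     2 * implicit_slope \<epsilon> c \<phi> K s0 k1 s) (at s)"
proof -
  have "((\<lambda>u. LBINT v=s0..u. implicit_slope \<epsilon> c \<phi> K s0 k1 v) has_real_derivative
      implicit_slope \<epsilon> c \<phi> K s0 k1 s) (at s)"
    by (intro interval_integral_has_real_derivative[OF assms(1-4)]
        continuous_on_implicit_slope assms)
  then show ?thesis
    unfolding implicit_rhs_def implicit_slope_def[symmetric]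
    by (auto intro!: derivative_eq_intros)
qed

lemma arclength_curve_derivatives:
  assumes "arclength_curve \<epsilon> J x y" "s \<in> J"
  shows "(x has_real_derivative deriv x s) (at s)" "(y has_real_derivative deriv y s) (at s)"
    and "(deriv x has_real_derivative deriv (deriv x) s) (at s)"
    and "(deriv y has_real_derivative deriv (deriv y) s) (at s)"
    and "(deriv x s)\<^sup>2 - (deriv y s)\<^sup>2 = \<epsilon>"
proof -
  have "(f has_real_derivative deriv f s) (at s)" if "f C1_differentiable_on J" for f
    using that assms(2) by (simp add: C1_differentiable_on_eq DERIV_deriv_iff_real_differentiable)
  then show "(x has_real_derivative deriv x s) (at s)" "(y has_real_derivative deriv y s) (at s)"
    "(deriv x has_real_derivative deriv (deriv x) s) (at s)"
    "(deriv y has_real_derivative deriv (deriv y) s) (at s)"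
    using assms(1) by (simp_all add: arclength_curve_def C2_on_def)
  show "(deriv x s)\<^sup>2 - (deriv y s)\<^sup>2 = \<epsilon>"
    using assms by (simp add: arclength_curve_def)
qed

lemma implicit_equation_slope:
  assumes "is_interval J" "open J" "s0 \<in> J" "s \<in> J" "continuous_on J K"
    and "rhs_defined_on \<epsilon> c \<phi> K s0 k1 J"
    and curve: "arclength_curve \<epsilon> J x y" and "implicit_equation \<epsilon> c \<phi> K s0 k0 k1 J x y"
  shows "x s * deriv x s - y s * deriv y s = implicit_slope \<epsilon> c \<phi> K s0 k1 s"
proof -
  have "((\<lambda>u. (x u)\<^sup>2 - (y u)\<^sup>2) has_real_derivative 2 * (x s * deriv x s - y s * deriv y s)) (at s)"
    by (auto intro!: derivative_eq_intros arclength_curve_derivatives[OF curve \<open>s \<in> J\<close>])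
  moreover have "((\<lambda>u. (x u)\<^sup>2 - (y u)\<^sup>2) has_real_derivative
      2 * implicit_slope \<epsilon> c \<phi> K s0 k1 s) (at s)"
    by (rule has_field_derivative_transform_within_open
        [OF implicit_rhs_has_real_derivative[OF assms(1-6)] \<open>open J\<close> \<open>s \<in> J\<close>])
       (use assms(8) in \<open>simp add: implicit_equation_def\<close>)
  ultimately show ?thesis
    using DERIV_unique by fastforce
qed

text \<open>The implicit equation determines \<open>x x' - y y'\<close>, and the curvature of an arc-length curve
  depends on nothing else.\<close>
lemma implicit_equation_imp_gauss_curvature:
  assumes "c \<noteq> 0" "\<phi> \<noteq> 0" and \<epsilon>: "\<epsilon> \<in> {-1, 1}"
    and J: "is_interval J" "open J" "s0 \<in> J" and K: "continuous_on J K"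
    and R: "rhs_defined_on \<epsilon> c \<phi> K s0 k1 J"
    and curve: "arclength_curve \<epsilon> J x y" "implicit_equation \<epsilon> c \<phi> K s0 k0 k1 J x y"
  shows "has_gauss_curvature c \<phi> K J x y"
  unfolding has_gauss_curvature_def
proof (intro ballI allI)
  fix s t assume s: "s \<in> J"
  define g where "g = implicit_slope \<epsilon> c \<phi> K s0 k1"
  have R_s: "radicand \<epsilon> c \<phi> K s0 k1 s \<noteq> 0"
    using R s by (simp add: rhs_defined_on_def)
  have "g s ^ 3 \<noteq> 0"
    using R_s by (simp add: g_def implicit_slope_power3)
  then have g: "g s \<noteq> 0" by auto
  have g': "(g has_real_derivative \<epsilon> * \<phi>\<^sup>2 / c\<^sup>2 * K s * g s ^ 4) (at s)"
    unfolding g_def by (rule implicit_slope_has_real_derivative[OF J s K R_s])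
  note curv = helicoidal_ni_curvature_arclength[OF J(2) s
    arclength_curve_derivatives(1,2)[OF curve(1)]
    arclength_curve_derivatives(3,4)[OF curve(1) s]
    arclength_curve_derivatives(5)[OF curve(1)] \<open>\<phi> \<noteq> 0\<close>
    implicit_equation_slope[OF J _ K R curve, folded g_def] g' g, of c t]
  have "\<epsilon> * \<epsilon> = 1"
    using \<epsilon> by auto
  then have "\<epsilon> * c\<^sup>2 / \<phi>\<^sup>2 * ((\<epsilon> * \<phi>\<^sup>2 / c\<^sup>2 * K s * g s ^ 4) / g s ^ 4) = K s"
    using g \<open>c \<noteq> 0\<close> \<open>\<phi> \<noteq> 0\<close> by (simp add: field_simps)
  then show "admissible_at (helicoidal_ni c \<phi> x y) s t \<and>
      gauss_curvature (helicoidal_ni c \<phi> x y) s t = K s"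
    using curv by simp
qed

lemma implicit_equation_constants:
  assumes J: "is_interval J" "open J" "s0 \<in> J" and K: "continuous_on J K"
    and R: "rhs_defined_on \<epsilon> c \<phi> K s0 k1 J"
    and curve: "arclength_curve \<epsilon> J x y" "implicit_equation \<epsilon> c \<phi> K s0 k0 k1 J x y"
  shows "k0 = (x s0)\<^sup>2 - (y s0)\<^sup>2"
    and "k1 = 1 / (x s0 * deriv x s0 - y s0 * deriv y s0) ^ 3"
proof -
  show "k0 = (x s0)\<^sup>2 - (y s0)\<^sup>2"
    using curve(2)[unfolded implicit_equation_def, rule_format, OF J(3)]
    by (simp add: implicit_rhs_start)
  show "k1 = 1 / (x s0 * deriv x s0 - y s0 * deriv y s0) ^ 3"
    unfolding implicit_equation_slope[OF J J(3) K R curve] implicit_slope_power3 radicand_start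
    by simp
qed

section \<open>Solving the implicit equation\<close>

lemma has_real_derivative_at_imp_continuous_on:
  assumes "\<And>s. s \<in> J \<Longrightarrow> (f has_real_derivative f' s) (at s)"
  shows "continuous_on J f"
  by (rule DERIV_continuous_on, rule has_field_derivative_at_within, rule assms)

lemma C2_onI:
  assumes "open J"
    and x: "\<And>s. s \<in> J \<Longrightarrow> (x has_real_derivative x1 s) (at s)"
    and x1: "\<And>s. s \<in> J \<Longrightarrow> (x1 has_real_derivative x2 s) (at s)"
    and x2: "continuous_on J x2"
  shows "C2_on J x"
proof -
  have eq: "deriv x s = x1 s" if "s \<in> J" for s
    using x[OF that] by (rule DERIV_imp_deriv)
  have "(deriv x has_real_derivative x2 s) (at s)" if "s \<in> J" for s
    by (rule has_field_derivative_transform_within_open[OF x1[OF that] \<open>open J\<close> that])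
       (simp add: eq)
  moreover have "continuous_on J x1"
    using x1 by (rule has_real_derivative_at_imp_continuous_on)
  ultimately show ?thesis
    using x x2 unfolding C2_on_def C1_differentiable_on_def
      has_real_derivative_iff_has_vector_derivative[symmetric] by blast
qed

text \<open>The point at hyperbolic angle \<open>\<theta>\<close> on a branch of the unit hyperbola with square \<open>\<epsilon>\<close>:
  \<open>(cosh \<theta>, sinh \<theta>)\<close> for \<open>\<epsilon> = 1\<close> and \<open>(sinh \<theta>, cosh \<theta>)\<close> for \<open>\<epsilon> = -1\<close>.  The exponential form
  treats both causal characters at once.\<close>
definition tangent_x :: "real \<Rightarrow> real \<Rightarrow> real" where
  "tangent_x \<epsilon> \<theta> = (exp \<theta> + \<epsilon> * exp (- \<theta>)) / 2"

definition tangent_y :: "real \<Rightarrow> real \<Rightarrow> real" where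
  "tangent_y \<epsilon> \<theta> = (exp \<theta> - \<epsilon> * exp (- \<theta>)) / 2"

lemma tangent_norm: "(tangent_x \<epsilon> \<theta>)\<^sup>2 - (tangent_y \<epsilon> \<theta>)\<^sup>2 = \<epsilon>"
proof -
  have "exp \<theta> * exp (- \<theta>) = 1"
    by (simp add: exp_minus)
  then show ?thesis
    unfolding tangent_x_def tangent_y_def by (simp add: power2_eq_square field_simps)
qed

lemma tangent_has_real_derivative:
  assumes "(\<theta> has_real_derivative \<theta>') (at s)"
  shows "((\<lambda>s. tangent_x \<epsilon> (\<theta> s)) has_real_derivative \<theta>' * tangent_y \<epsilon> (\<theta> s)) (at s)"
    and "((\<lambda>s. tangent_y \<epsilon> (\<theta> s)) has_real_derivative \<theta>' * tangent_x \<epsilon> (\<theta> s)) (at s)"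
  unfolding tangent_x_def tangent_y_def
  by (auto intro!: derivative_eq_intros assms simp: field_simps)

text \<open>Reconstruction of a curve from its components in the frame \<open>T = (p, q)\<close>, \<open>N = (q, p)\<close>.
  Since \<open>T' = \<theta>' N\<close> and \<open>N' = \<theta>' T\<close>, the two differential equations assumed below say that
  \<open>\<epsilon> g T + \<mu> N\<close> has derivative \<open>T\<close>.  Since the square of \<open>T\<close> is \<open>\<epsilon>\<close>, that of \<open>N\<close> is \<open>- \<epsilon>\<close>,
  and they are orthogonal, the position has square \<open>\<epsilon> (g\<^sup>2 - \<mu>\<^sup>2)\<close>.\<close>
lemma moving_frame_curve:
  fixes \<epsilon> :: real and g \<mu> \<theta> g' \<theta>' :: "real \<Rightarrow> real"
  defines "x \<equiv> \<lambda>s. \<epsilon> * g s * tangent_x \<epsilon> (\<theta> s) + \<mu> s * tangent_y \<epsilon> (\<theta> s)"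
    and "y \<equiv> \<lambda>s. \<epsilon> * g s * tangent_y \<epsilon> (\<theta> s) + \<mu> s * tangent_x \<epsilon> (\<theta> s)"
  assumes \<epsilon>: "\<epsilon> \<in> {-1, 1}" and J: "open J"
    and g: "\<And>s. s \<in> J \<Longrightarrow> (g has_real_derivative g' s) (at s)"
    and \<mu>: "\<And>s. s \<in> J \<Longrightarrow> (\<mu> has_real_derivative - \<epsilon> * g s * \<theta>' s) (at s)"
    and \<theta>: "\<And>s. s \<in> J \<Longrightarrow> (\<theta> has_real_derivative \<theta>' s) (at s)"
    and eq: "\<And>s. s \<in> J \<Longrightarrow> \<epsilon> * g' s + \<mu> s * \<theta>' s = 1"
    and cont: "continuous_on J \<theta>'"
  shows "arclength_curve \<epsilon> J x y" and "(x s)\<^sup>2 - (y s)\<^sup>2 = \<epsilon> * ((g s)\<^sup>2 - (\<mu> s)\<^sup>2)"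
proof -
  have x': "(x has_real_derivative tangent_x \<epsilon> (\<theta> s)) (at s)"
    and y': "(y has_real_derivative tangent_y \<epsilon> (\<theta> s)) (at s)" if s: "s \<in> J" for s
  proof -
    let ?p = "tangent_x \<epsilon> (\<theta> s)" and ?q = "tangent_y \<epsilon> (\<theta> s)"
    note d = derivative_eq_intros g[OF s] \<mu>[OF s] tangent_has_real_derivative[OF \<theta>[OF s]] refl
    have "(x has_real_derivative (\<epsilon> * g' s + \<mu> s * \<theta>' s) * ?p) (at s)"
      unfolding x_def by (rule d)+ (simp add: algebra_simps)
    then show "(x has_real_derivative ?p) (at s)"
      by (simp add: eq[OF s])
    have "(y has_real_derivative (\<epsilon> * g' s + \<mu> s * \<theta>' s) * ?q) (at s)"
      unfolding y_def by (rule d)+ (simp add: algebra_simps)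
    then show "(y has_real_derivative ?q) (at s)"
      by (simp add: eq[OF s])
  qed
  note x'' = tangent_has_real_derivative(1)[OF \<theta>]
  note y'' = tangent_has_real_derivative(2)[OF \<theta>]
  have "continuous_on J (\<lambda>s. tangent_x \<epsilon> (\<theta> s))" "continuous_on J (\<lambda>s. tangent_y \<epsilon> (\<theta> s))"
    by (rule has_real_derivative_at_imp_continuous_on, rule x'' y'', assumption)+
  then have "C2_on J x" "C2_on J y"
    by (auto intro!: C2_onI[OF J x' x''] C2_onI[OF J y' y''] continuous_intros cont)
  moreover have "deriv x s = tangent_x \<epsilon> (\<theta> s)" "deriv y s = tangent_y \<epsilon> (\<theta> s)" if "s \<in> J" for s
    using x'[OF that] y'[OF that] by (auto intro: DERIV_imp_deriv)
  ultimately show "arclength_curve \<epsilon> J x y"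
    by (simp add: arclength_curve_def tangent_norm)
  have "\<epsilon> * \<epsilon> = 1"
    using \<epsilon> by auto
  have "(x s)\<^sup>2 - (y s)\<^sup>2 = (\<epsilon> * \<epsilon> * (g s)\<^sup>2 - (\<mu> s)\<^sup>2) *
      ((tangent_x \<epsilon> (\<theta> s))\<^sup>2 - (tangent_y \<epsilon> (\<theta> s))\<^sup>2)"
    unfolding x_def y_def by algebra
  then show "(x s)\<^sup>2 - (y s)\<^sup>2 = \<epsilon> * ((g s)\<^sup>2 - (\<mu> s)\<^sup>2)"
    by (simp add: tangent_norm \<open>\<epsilon> * \<epsilon> = 1\<close>)
qed

text \<open>The choice of \<open>\<mu>\<close> for which the position vector has the prescribed square.\<close>
definition normal_component ::
    "real \<Rightarrow> real \<Rightarrow> real \<Rightarrow> (real \<Rightarrow> real) \<Rightarrow> real \<Rightarrow> real \<Rightarrow> real \<Rightarrow> real \<Rightarrow> real" where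
  "normal_component \<epsilon> c \<phi> K s0 k0 k1 s =
     sqrt ((implicit_slope \<epsilon> c \<phi> K s0 k1 s)\<^sup>2 - \<epsilon> * implicit_rhs \<epsilon> c \<phi> K s0 k0 k1 s)"

text \<open>The solution \<open>\<theta>'\<close> of \<open>\<epsilon> g' + \<mu> \<theta>' = 1\<close>, with \<open>g'\<close> replaced by its value in terms of \<open>K\<close>
  so that \<open>\<theta>'\<close> is visibly continuous.\<close>
definition turning_rate ::
    "real \<Rightarrow> real \<Rightarrow> real \<Rightarrow> (real \<Rightarrow> real) \<Rightarrow> real \<Rightarrow> real \<Rightarrow> real \<Rightarrow> real \<Rightarrow> real" where
  "turning_rate \<epsilon> c \<phi> K s0 k0 k1 s =
     (1 - \<phi>\<^sup>2 / c\<^sup>2 * K s * implicit_slope \<epsilon> c \<phi> K s0 k1 s ^ 4) /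
     normal_component \<epsilon> c \<phi> K s0 k0 k1 s"

definition tangent_angle ::
    "real \<Rightarrow> real \<Rightarrow> real \<Rightarrow> (real \<Rightarrow> real) \<Rightarrow> real \<Rightarrow> real \<Rightarrow> real \<Rightarrow> real \<Rightarrow> real" where
  "tangent_angle \<epsilon> c \<phi> K s0 k0 k1 s = (LBINT v=s0..s. turning_rate \<epsilon> c \<phi> K s0 k0 k1 v)"

definition curve_x ::
    "real \<Rightarrow> real \<Rightarrow> real \<Rightarrow> (real \<Rightarrow> real) \<Rightarrow> real \<Rightarrow> real \<Rightarrow> real \<Rightarrow> real \<Rightarrow> real" where
  "curve_x \<epsilon> c \<phi> K s0 k0 k1 s =
     \<epsilon> * implicit_slope \<epsilon> c \<phi> K s0 k1 s * tangent_x \<epsilon> (tangent_angle \<epsilon> c \<phi> K s0 k0 k1 s) +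
     normal_component \<epsilon> c \<phi> K s0 k0 k1 s * tangent_y \<epsilon> (tangent_angle \<epsilon> c \<phi> K s0 k0 k1 s)"

definition curve_y ::
    "real \<Rightarrow> real \<Rightarrow> real \<Rightarrow> (real \<Rightarrow> real) \<Rightarrow> real \<Rightarrow> real \<Rightarrow> real \<Rightarrow> real \<Rightarrow> real" where
  "curve_y \<epsilon> c \<phi> K s0 k0 k1 s =
     \<epsilon> * implicit_slope \<epsilon> c \<phi> K s0 k1 s * tangent_y \<epsilon> (tangent_angle \<epsilon> c \<phi> K s0 k0 k1 s) +
     normal_component \<epsilon> c \<phi> K s0 k0 k1 s * tangent_x \<epsilon> (tangent_angle \<epsilon> c \<phi> K s0 k0 k1 s)"

lemma curve_solves_implicit_equation:
  assumes \<epsilon>: "\<epsilon> \<in> {-1, 1}"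
    and J: "is_interval J" "open J" "s0 \<in> J" and K: "continuous_on J K"
    and R: "rhs_defined_on \<epsilon> c \<phi> K s0 k1 J"
    and solvable: "curve_solvable_on \<epsilon> c \<phi> K s0 k0 k1 J"
  defines "x \<equiv> curve_x \<epsilon> c \<phi> K s0 k0 k1" and "y \<equiv> curve_y \<epsilon> c \<phi> K s0 k0 k1"
  shows "arclength_curve \<epsilon> J x y" and "implicit_equation \<epsilon> c \<phi> K s0 k0 k1 J x y"
proof -
  define g where "g = implicit_slope \<epsilon> c \<phi> K s0 k1"
  define F where "F = implicit_rhs \<epsilon> c \<phi> K s0 k0 k1"
  define g' where "g' s = \<epsilon> * \<phi>\<^sup>2 / c\<^sup>2 * K s * g s ^ 4" for s
  define \<mu> where "\<mu> = normal_component \<epsilon> c \<phi> K s0 k0 k1"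
  define \<theta> where "\<theta> = tangent_angle \<epsilon> c \<phi> K s0 k0 k1"
  define \<theta>' where "\<theta>' = turning_rate \<epsilon> c \<phi> K s0 k0 k1"
  have \<epsilon>2: "\<epsilon> * \<epsilon> = 1"
    using \<epsilon> by auto
  have \<theta>'_eq: "\<theta>' s = (1 - \<epsilon> * g' s) / \<mu> s" for s
    using \<epsilon>2 by (simp add: \<theta>'_def turning_rate_def g'_def g_def \<mu>_def algebra_simps)
  have \<mu>_eq: "\<mu> s = sqrt ((g s)\<^sup>2 - \<epsilon> * F s)" for s
    by (simp add: \<mu>_def normal_component_def g_def F_def)
  have pos: "(g s)\<^sup>2 - \<epsilon> * F s > 0" if "s \<in> J" for s
    using solvable that by (simp add: curve_solvable_on_def g_def F_def implicit_slope_def)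
  have \<mu>_pos: "\<mu> s > 0" if "s \<in> J" for s
    using pos[OF that] by (simp add: \<mu>_eq)
  have g: "(g has_real_derivative g' s) (at s)" if "s \<in> J" for s
    unfolding g_def g'_def using R that
    by (intro implicit_slope_has_real_derivative[OF J that K]) (simp add: rhs_defined_on_def)
  have F: "(F has_real_derivative 2 * g s) (at s)" if "s \<in> J" for s
    unfolding F_def g_def by (rule implicit_rhs_has_real_derivative[OF J that K R])
  have \<mu>: "(\<mu> has_real_derivative - \<epsilon> * g s * \<theta>' s) (at s)" if s: "s \<in> J" for s
  proof -
    have "((\<lambda>s. (g s)\<^sup>2 - \<epsilon> * F s) has_real_derivative 2 * g s * (g' s - \<epsilon>)) (at s)"
      by (rule derivative_eq_intros g[OF s] F[OF s] refl)+ (simp add: algebra_simps)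
    from DERIV_chain2[OF DERIV_real_sqrt[OF pos[OF s]] this]
    have "(\<mu> has_real_derivative inverse (\<mu> s) / 2 * (2 * g s * (g' s - \<epsilon>))) (at s)"
      by (simp add: \<mu>_eq[abs_def])
    moreover have "\<epsilon> * (1 - \<epsilon> * g' s) = \<epsilon> - g' s"
      using \<epsilon>2 by algebra
    then have "inverse (\<mu> s) / 2 * (2 * g s * (g' s - \<epsilon>)) = - \<epsilon> * g s * \<theta>' s"
      using \<mu>_pos[OF s] unfolding \<theta>'_eq by (simp add: field_simps, algebra)
    ultimately show ?thesis by simp
  qed
  have "continuous_on J g" "continuous_on J \<mu>"
    by (rule has_real_derivative_at_imp_continuous_on, rule g \<mu>, assumption)+
  then have \<theta>'_cont: "continuous_on J \<theta>'"
    unfolding \<theta>'_eq[abs_def] g'_def using \<mu>_pos K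
    by (intro continuous_intros ballI) (simp_all add: less_imp_neq[symmetric])
  then have \<theta>: "(\<theta> has_real_derivative \<theta>' s) (at s)" if "s \<in> J" for s
    unfolding \<theta>_def \<theta>'_def tangent_angle_def
    by (intro interval_integral_has_real_derivative[OF J that])
  have eq: "\<epsilon> * g' s + \<mu> s * \<theta>' s = 1" if "s \<in> J" for s
    using \<mu>_pos[OF that] by (simp add: \<theta>'_eq)
  note curve = moving_frame_curve[OF \<epsilon> J(2) g \<mu> \<theta> eq \<theta>'_cont]
  have x_eq: "x = (\<lambda>s. \<epsilon> * g s * tangent_x \<epsilon> (\<theta> s) + \<mu> s * tangent_y \<epsilon> (\<theta> s))"
    and y_eq: "y = (\<lambda>s. \<epsilon> * g s * tangent_y \<epsilon> (\<theta> s) + \<mu> s * tangent_x \<epsilon> (\<theta> s))"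
    by (simp_all add: x_def y_def fun_eq_iff curve_x_def curve_y_def g_def \<mu>_def \<theta>_def)
  show "arclength_curve \<epsilon> J x y"
    unfolding x_eq y_eq by (rule curve(1))
  show "implicit_equation \<epsilon> c \<phi> K s0 k0 k1 J x y"
    unfolding implicit_equation_def
  proof
    fix s assume s: "s \<in> J"
    have "(x s)\<^sup>2 - (y s)\<^sup>2 = \<epsilon> * ((g s)\<^sup>2 - (\<mu> s)\<^sup>2)"
      unfolding x_eq y_eq by (rule curve(2))
    also have "(\<mu> s)\<^sup>2 = (g s)\<^sup>2 - \<epsilon> * F s"
      using pos[OF s] by (simp add: \<mu>_eq)
    also have "\<epsilon> * ((g s)\<^sup>2 - ((g s)\<^sup>2 - \<epsilon> * F s)) = F s"
      using \<epsilon>2 by algebra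
    finally show "(x s)\<^sup>2 - (y s)\<^sup>2 = implicit_rhs \<epsilon> c \<phi> K s0 k0 k1 s"
      by (simp add: F_def)
  qed
qed

text \<open>Both conditions are strict and hold at \<open>s0\<close>, where the radicand is \<open>k1\<close> and the right-hand
  side is \<open>k0\<close>, so they persist nearby by continuity.  The interval is shrunk twice: the
  right-hand side is only known to be continuous where the radicand does not vanish.\<close>
lemma solvable_interval_exists:
  assumes "s0 \<in> interior I" and K: "continuous_on I K"
    and "k1 \<noteq> 0" and k0: "\<epsilon> * k0 < (root 3 (1 / k1))\<^sup>2"
  shows "\<exists>J. interval_around s0 I J \<and> rhs_defined_on \<epsilon> c \<phi> K s0 k1 J \<and>
    curve_solvable_on \<epsilon> c \<phi> K s0 k0 k1 J"
proof -
  have ball: "is_interval (ball s0 e)" "open (ball s0 e)" for e :: real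
    by (simp_all add: is_interval_ball_real)
  obtain a where a: "a > 0" "ball s0 a \<subseteq> I"
    using assms(1) mem_interior by blast
  have K_a: "continuous_on (ball s0 a) K"
    using K a(2) by (rule continuous_on_subset)
  have "isCont (radicand \<epsilon> c \<phi> K s0 k1) s0"
    by (rule DERIV_isCont, rule radicand_has_real_derivative[OF ball _ _ K_a]) (use a in auto)
  then have "(radicand \<epsilon> c \<phi> K s0 k1 \<longlongrightarrow> k1) (nhds s0)"
    unfolding isCont_def tendsto_at_iff_tendsto_nhds unfolding radicand_start .
  then have "\<forall>\<^sub>F v in nhds s0. radicand \<epsilon> c \<phi> K s0 k1 v \<noteq> 0"
    using \<open>k1 \<noteq> 0\<close> by (rule tendsto_imp_eventually_ne)
  then obtain b where b: "b > 0" "\<And>v. v \<in> ball s0 b \<Longrightarrow> radicand \<epsilon> c \<phi> K s0 k1 v \<noteq> 0"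
    unfolding eventually_nhds_metric by (auto simp: dist_commute)
  define r where "r = min a b"
  have "r > 0" "ball s0 r \<subseteq> ball s0 a" "ball s0 r \<subseteq> ball s0 b"
    using a b by (auto simp: r_def)
  then have s0_r: "s0 \<in> ball s0 r" and K_r: "continuous_on (ball s0 r) K"
    and R_r: "rhs_defined_on \<epsilon> c \<phi> K s0 k1 (ball s0 r)"
    using b(2) continuous_on_subset[OF K_a] by (auto simp: rhs_defined_on_def)
  define G where "G s = (implicit_slope \<epsilon> c \<phi> K s0 k1 s)\<^sup>2 - \<epsilon> * implicit_rhs \<epsilon> c \<phi> K s0 k0 k1 s" for s
  have "isCont (implicit_slope \<epsilon> c \<phi> K s0 k1) s0"
    using continuous_on_implicit_slope[OF ball s0_r K_r R_r] s0_r
    by (simp add: continuous_on_eq_continuous_at)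
  moreover have "isCont (implicit_rhs \<epsilon> c \<phi> K s0 k0 k1) s0"
    by (rule DERIV_isCont, rule implicit_rhs_has_real_derivative[OF ball s0_r s0_r K_r R_r])
  ultimately have "isCont G s0"
    unfolding G_def by (intro continuous_intros)
  moreover have "G s0 > 0"
    using k0 by (simp add: G_def implicit_slope_def radicand_start implicit_rhs_start)
  ultimately have "\<forall>\<^sub>F s in nhds s0. G s > 0"
    unfolding isCont_def tendsto_at_iff_tendsto_nhds by (rule order_tendstoD(1))
  then obtain d where d: "d > 0" "\<And>s. s \<in> ball s0 d \<Longrightarrow> G s > 0"
    unfolding eventually_nhds_metric by (auto simp: dist_commute)
  define J where "J = ball s0 (min r d)"
  have "J \<subseteq> ball s0 r" "J \<subseteq> ball s0 d" "s0 \<in> J"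
    using \<open>r > 0\<close> d(1) by (auto simp: J_def)
  have "interval_around s0 I J"
    using ball \<open>s0 \<in> J\<close> \<open>J \<subseteq> ball s0 r\<close> \<open>ball s0 r \<subseteq> ball s0 a\<close> a(2)
    unfolding interval_around_def J_def by blast
  moreover have "rhs_defined_on \<epsilon> c \<phi> K s0 k1 J"
    using R_r \<open>J \<subseteq> ball s0 r\<close> by (auto simp: rhs_defined_on_def)
  moreover have "curve_solvable_on \<epsilon> c \<phi> K s0 k0 k1 J"
    using d(2) \<open>J \<subseteq> ball s0 d\<close>
    by (force simp: curve_solvable_on_def G_def implicit_slope_def)
  ultimately show ?thesis by blast
qed

theorem theorem6p2:
  fixes c \<phi> \<epsilon> s0 :: real and K :: "real \<Rightarrow> real" and I :: "real set"
  assumes "c \<noteq> 0" and "\<phi> \<noteq> 0"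
    and "is_interval I" and "s0 \<in> interior I" and "continuous_on I K"
    and "\<epsilon> \<in> {-1, 1}"
  shows
    "(\<exists>X Y :: real \<Rightarrow> real \<Rightarrow> real \<Rightarrow> real.
        \<forall>k0 k1. k1 \<noteq> 0 \<and> \<epsilon> * k0 < (root 3 (1 / k1))\<^sup>2 \<longrightarrow>
          (\<exists>J. interval_around s0 I J \<and> rhs_defined_on \<epsilon> c \<phi> K s0 k1 J \<and>
               curve_solvable_on \<epsilon> c \<phi> K s0 k0 k1 J) \<and>
          (\<forall>J. interval_around s0 I J \<and> rhs_defined_on \<epsilon> c \<phi> K s0 k1 J \<and>
               curve_solvable_on \<epsilon> c \<phi> K s0 k0 k1 J \<longrightarrow>
               arclength_curve \<epsilon> J (X k0 k1) (Y k0 k1) \<and>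
               implicit_equation \<epsilon> c \<phi> K s0 k0 k1 J (X k0 k1) (Y k0 k1) \<and>
               has_gauss_curvature c \<phi> K J (X k0 k1) (Y k0 k1)))
     \<and>
     (\<forall>k0 k1 J x y.
        interval_around s0 I J \<and> rhs_defined_on \<epsilon> c \<phi> K s0 k1 J \<and>
        arclength_curve \<epsilon> J x y \<and> implicit_equation \<epsilon> c \<phi> K s0 k0 k1 J x y \<longrightarrow>
          has_gauss_curvature c \<phi> K J x y \<and>
          k0 = (x s0)\<^sup>2 - (y s0)\<^sup>2 \<and>
          k1 = 1 / (x s0 * deriv x s0 - y s0 * deriv y s0) ^ 3)"
proof (intro conjI allI impI,
    rule exI[of _ "curve_x \<epsilon> c \<phi> K s0"], rule exI[of _ "curve_y \<epsilon> c \<phi> K s0"],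
    intro allI impI conjI)
  fix k0 k1 assume k: "k1 \<noteq> 0 \<and> \<epsilon> * k0 < (root 3 (1 / k1))\<^sup>2"
  show "\<exists>J. interval_around s0 I J \<and> rhs_defined_on \<epsilon> c \<phi> K s0 k1 J \<and>
      curve_solvable_on \<epsilon> c \<phi> K s0 k0 k1 J"
    using k by (intro solvable_interval_exists[OF assms(4,5)]) simp_all
next
  fix k0 k1 J assume "interval_around s0 I J \<and> rhs_defined_on \<epsilon> c \<phi> K s0 k1 J \<and>
      curve_solvable_on \<epsilon> c \<phi> K s0 k0 k1 J"
  then have J: "is_interval J" "open J" "s0 \<in> J" and K: "continuous_on J K"
    and R: "rhs_defined_on \<epsilon> c \<phi> K s0 k1 J" and S: "curve_solvable_on \<epsilon> c \<phi> K s0 k0 k1 J"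
    using continuous_on_subset[OF assms(5)] by (auto simp: interval_around_def)
  note curve = curve_solves_implicit_equation[OF assms(6) J K R S]
  show "arclength_curve \<epsilon> J (curve_x \<epsilon> c \<phi> K s0 k0 k1) (curve_y \<epsilon> c \<phi> K s0 k0 k1)"
    and "implicit_equation \<epsilon> c \<phi> K s0 k0 k1 J
      (curve_x \<epsilon> c \<phi> K s0 k0 k1) (curve_y \<epsilon> c \<phi> K s0 k0 k1)"
    by (rule curve)+
  show "has_gauss_curvature c \<phi> K J (curve_x \<epsilon> c \<phi> K s0 k0 k1) (curve_y \<epsilon> c \<phi> K s0 k0 k1)"
    by (rule implicit_equation_imp_gauss_curvature[OF assms(1,2,6) J K R curve])
next
  fix k0 k1 J x y
  assume "interval_around s0 I J \<and> rhs_defined_on \<epsilon> c \<phi> K s0 k1 J \<and>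
      arclength_curve \<epsilon> J x y \<and> implicit_equation \<epsilon> c \<phi> K s0 k0 k1 J x y"
  then have J: "is_interval J" "open J" "s0 \<in> J" and K: "continuous_on J K"
    and R: "rhs_defined_on \<epsilon> c \<phi> K s0 k1 J"
    and curve: "arclength_curve \<epsilon> J x y" "implicit_equation \<epsilon> c \<phi> K s0 k0 k1 J x y"
    using continuous_on_subset[OF assms(5)] by (auto simp: interval_around_def)
  show "has_gauss_curvature c \<phi> K J x y"
    by (rule implicit_equation_imp_gauss_curvature[OF assms(1,2,6) J K R curve])
  show "k0 = (x s0)\<^sup>2 - (y s0)\<^sup>2" "k1 = 1 / (x s0 * deriv x s0 - y s0 * deriv y s0) ^ 3"
    by (rule implicit_equation_constants[OF J K R curve])+
qed

end
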